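(* Let $\Sigma: x^+=f(x,u)$ be a discrete-time system with state $x\in\mathcal{X}\subseteq\mathbb{R}^n$ and input $u\in\mathcal{U}\subseteq\mathbb{R}^m$, and let $S_{xu}=S_x\times S_u\subseteq\mathcal{X}\times\mathcal{U}$ be a constraint set. Given a subdomain $\tilde S\subseteq S_{xu}$, a data set $\mathcal{D}$ with dispersion $b$ in $S_{xu}$, a lifting function $\psi:\mathcal{X}\to\mathbb{R}^p$, and matrices $A,\tilde A\in\mathbb{R}^{p\times p}$, $B,\tilde B\in\mathbb{R}^{p\times m}$, consider the Lipschitz constants $L_{\Delta_{\tilde A,\tilde B}}$ and $L_{E_{A,B}}$ of the functions $\Delta_{\tilde A,\tilde B}(x,u)=E_{\tilde A,\tilde B}(x,u)-E_{A,B}(x,u)=(A-\tilde A)\psi(x)+(B-\tilde B)u$ and $E_{A,B}(x,u)=\psi(f(x,u))-A\psi(x)-Bu$. Define $\tilde{\mathcal{D}}\subseteq\mathcal{D}$ such that its set of state-input pairs is $\tilde{\mathcal{D}}_{xu}=\mathcal{D}_{xu}\cap(\tilde S\oplus\mathcal{B}(0,b))$, and $$\tilde e(\tilde A,\tilde B)=\min_{\tilde c}\ \max_{(\bar x,\bar u,\bar x^+)\in\tilde{\mathcal{D}}}\|\psi(\bar x^+)-\tilde A\psi(\bar x)-\tilde B\bar u-\tilde c\|,$$ with $\tilde c^*$ as the minimizer. Let $\tilde\epsilon=(L_{\Delta_{\tilde A,\tilde B}}+L_{E_{A,B}})\,b+\tilde e(\tilde A,\tilde B)$. Then the linear system $\tilde\Sigma_{lin}$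 defined by $\tilde A$, $\tilde B$ and $\tilde W=\mathcal{B}(\tilde c^*,\tilde\epsilon)$, i.e. $z^+=\tilde Az+\tilde Bu+w$ with $w\in\tilde W$, is a Koopman over-approximation of $\Sigma$ (with lifting function $\psi$) over the subdomain $\tilde S$.
   Context: $\|\cdot\|$ denotes a norm, $\mathcal{B}(c,r)$ is the closed norm ball with center $c$ and radius $r$, and $\oplus$ is the Minkowski sum. $L_h$ denotes a Lipschitz constant of a function $h$: $\|h(y)-h(y')\|\le L_h\|y-y'\|$ for all $y,y'$ in its domain. For matrices $\tilde A,\tilde B$, $E_{\tilde A,\tilde B}(x,u)=\psi(f(x,u))-\tilde A\psi(x)-\tilde Bu$; these functions are defined for $(x,u)\in\mathcal{X}\times\mathcal{U}$. Data set: a finite set $\mathcal{D}=\{(x_i,u_i,x_i^+)\}_{i=1}^N$ of state-input pairs $(x_i,u_i)$ together with $x_i^+=f(x_i,u_i)$; $\mathcal{D}_{xu}$ denotes the set of state-input pairs $(x_i,u_i)$ in $\mathcal{D}$. It is not required that $\mathcal{D}_{xu}\subseteq S_{xu}$. Dispersion: the dispersion of $\mathcal{D}$ (i.e. of $\mathcal{D}_{xu}$) in $S_{xu}$ is $b=\sup_{(x,u)\in S_{xu}}\min_{(\bar x,\bar u)\in\mathcal{D}_{xu}}\|(x,u)-(\bar x,\bar u)\|$. Koopman over-approximation: given a linear system $\Sigma_{lin}: z^+=Az+Bu+w$ with $z\in\mathbb{R}^p$, $u\in\mathcal{U}$, $w\in W\subseteq\mathbb{R}^p$, the tuple $(\psi,\Sigma_{lin})$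 (or, when $\psi$ is clear, $\Sigma_{lin}$) is a Koopman over-approximation of $\Sigma$ over subdomains $\mathcal{X}_{sub}\subseteq\mathcal{X}$ and $\mathcal{U}_{sub}\subseteq\mathcal{U}$ if $E_{A,B}(x,u)\in W$ for all $(x,u)\in\mathcal{X}_{sub}\times\mathcal{U}_{sub}$. For a subdomain $\tilde S\subseteq S_{xu}$, being a Koopman over-approximation over $\tilde S$ means the same inclusion for all $(x,u)\in\tilde S$ (with $\tilde A,\tilde B,\tilde W$ in place of $A,B,W$). *)

theory Defs
  imports "HOL-Analysis.Analysis" "HOL-Library.Set_Algebras"
begin

text \<open>
  The norms are arbitrary, not the Euclidean norm attached to the types \<open>real ^ 'n\<close>;
  they are therefore explicit functions. Nonnegativity follows from the three axioms.
\<close>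

definition is_norm :: "('a::real_vector \<Rightarrow> real) \<Rightarrow> bool" where
  "is_norm N \<longleftrightarrow>
     (\<forall>x. N x = 0 \<longleftrightarrow> x = 0) \<and>
     (\<forall>a x. N (a *\<^sub>R x) = \<bar>a\<bar> * N x) \<and>
     (\<forall>x y. N (x + y) \<le> N x + N y)"

definition norm_ball :: "('a::real_vector \<Rightarrow> real) \<Rightarrow> 'a \<Rightarrow> real \<Rightarrow> 'a set" where
  "norm_ball N c r = {y. N (y - c) \<le> r}"

definition is_Lipschitz_constant ::
  "('a::real_vector \<Rightarrow> real) \<Rightarrow> ('b::real_vector \<Rightarrow> real) \<Rightarrow> 'a set \<Rightarrow> ('a \<Rightarrow> 'b) \<Rightarrow> real \<Rightarrow> bool" where
  "is_Lipschitz_constant N M Y h L \<longleftrightarrow>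
     (\<forall>y\<in>Y. \<forall>y'\<in>Y. M (h y - h y') \<le> L * N (y - y'))"

definition is_data_set ::
  "('x \<Rightarrow> 'u \<Rightarrow> 'x) \<Rightarrow> 'x set \<Rightarrow> 'u set \<Rightarrow> ('x \<times> 'u \<times> 'x) set \<Rightarrow> bool" where
  "is_data_set f X U D \<longleftrightarrow>
     finite D \<and> D \<noteq> {} \<and> (\<forall>(x, u, x')\<in>D. x \<in> X \<and> u \<in> U \<and> x' = f x u)"

definition state_input_pairs :: "('x \<times> 'u \<times> 'x) set \<Rightarrow> ('x \<times> 'u) set" where
  "state_input_pairs D = (\<lambda>(x, u, x'). (x, u)) ` D"

text \<open>
  The supremum is taken in the extended reals, so that it is \<open>\<infinity>\<close> when the distances to the
  data are unbounded on \<open>S\<close>; the minimum is meant for a finite nonempty \<open>P\<close>.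
\<close>

definition dispersion :: "('a::real_vector \<Rightarrow> real) \<Rightarrow> 'a set \<Rightarrow> 'a set \<Rightarrow> ereal" where
  "dispersion N P S = (SUP s\<in>S. ereal (Min ((\<lambda>d. N (s - d)) ` P)))"

definition lifting_error ::
  "('x \<Rightarrow> real ^ 'm \<Rightarrow> 'x) \<Rightarrow> ('x \<Rightarrow> real ^ 'p) \<Rightarrow> real ^ 'p ^ 'p \<Rightarrow> real ^ 'm ^ 'p \<Rightarrow>
     'x \<times> (real ^ 'm) \<Rightarrow> real ^ 'p" where
  "lifting_error f \<psi> A B = (\<lambda>(x, u). \<psi> (f x u) - A *v \<psi> x - B *v u)"

definition lifting_error_diff ::
  "('x \<Rightarrow> real ^ 'm \<Rightarrow> 'x) \<Rightarrow> ('x \<Rightarrow> real ^ 'p) \<Rightarrow> real ^ 'p ^ 'p \<Rightarrow> real ^ 'm ^ 'p \<Rightarrow>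
     real ^ 'p ^ 'p \<Rightarrow> real ^ 'm ^ 'p \<Rightarrow> 'x \<times> (real ^ 'm) \<Rightarrow> real ^ 'p" where
  "lifting_error_diff f \<psi> A B A' B' =
     (\<lambda>xu. lifting_error f \<psi> A' B' xu - lifting_error f \<psi> A B xu)"

lemma lifting_error_diff_eq:
  "lifting_error_diff f \<psi> A B A' B' (x, u) = (A - A') *v \<psi> x + (B - B') *v u"
  by (simp add: lifting_error_diff_def lifting_error_def matrix_vector_mult_diff_rdistrib)

definition max_residual ::
  "(real ^ 'p \<Rightarrow> real) \<Rightarrow> ('x \<Rightarrow> real ^ 'p) \<Rightarrow> real ^ 'p ^ 'p \<Rightarrow> real ^ 'm ^ 'p \<Rightarrow>
     ('x \<times> (real ^ 'm) \<times> 'x) set \<Rightarrow> real ^ 'p \<Rightarrow> real" where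
  "max_residual M \<psi> A B D c =
     Max ((\<lambda>(x, u, x'). M (\<psi> x' - A *v \<psi> x - B *v u - c)) ` D)"

text \<open>For a norm \<open>M\<close> the infimum over \<open>c\<close> is attained, hence a minimum.\<close>

definition min_max_residual ::
  "(real ^ 'p \<Rightarrow> real) \<Rightarrow> ('x \<Rightarrow> real ^ 'p) \<Rightarrow> real ^ 'p ^ 'p \<Rightarrow> real ^ 'm ^ 'p \<Rightarrow>
     ('x \<times> (real ^ 'm) \<times> 'x) set \<Rightarrow> real" where
  "min_max_residual M \<psi> A B D = (INF c. max_residual M \<psi> A B D c)"

text \<open>
  The linear system \<open>z\<^sup>+ = A z + B u + w\<close> with \<open>w \<in> W\<close> is represented by its data \<open>A\<close>, \<open>B\<close>, \<open>W\<close>.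
  The subdomain \<open>S\<close> is a set of state-input pairs; it need not be a product.
\<close>

definition Koopman_over_approximation ::
  "('x \<Rightarrow> real ^ 'm \<Rightarrow> 'x) \<Rightarrow> ('x \<Rightarrow> real ^ 'p) \<Rightarrow> real ^ 'p ^ 'p \<Rightarrow> real ^ 'm ^ 'p \<Rightarrow>
     (real ^ 'p) set \<Rightarrow> ('x \<times> (real ^ 'm)) set \<Rightarrow> bool" where
  "Koopman_over_approximation f \<psi> A B W S \<longleftrightarrow> (\<forall>xu\<in>S. lifting_error f \<psi> A B xu \<in> W)"

end

theory Submission
  imports Defs
begin

text \<open>
  The function \<open>E\<^bsub>At,Bt\<^esub> = \<Delta> + E\<^bsub>A,B\<^esub>\<close> has Lipschitz constant \<open>L_Delta + L_E\<close>. Every point \<open>s\<close> of \<open>St\<close> has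
  a data point \<open>d\<close> within distance \<open>b\<close>, which therefore lies in the enlarged subdomain; so
  \<open>E\<^bsub>At,Bt\<^esub> s\<close> is within \<open>(L_Delta + L_E) b\<close> of \<open>E\<^bsub>At,Bt\<^esub> d\<close>, which is within \<open>et\<close> of \<open>ct\<close>.
\<close>

text \<open>Subadditivity and homogeneity give
  \<open>0 = N (x - x) \<le> N x + N (- x) = 2 * N x\<close>.\<close>

lemma is_norm_nonneg:
  assumes "is_norm N"
  shows "0 \<le> N x"
proof -
  have "N (x + (-1) *\<^sub>R x) \<le> N x + N ((-1) *\<^sub>R x)" and "N ((-1) *\<^sub>R x) = \<bar>-1\<bar> * N x" and "N 0 = 0"
    using assms unfolding is_norm_def by blast+
  then show ?thesis by simp
qed

lemma is_norm_minus_commute: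
  assumes "is_norm N"
  shows "N (x - y) = N (y - x)"
proof -
  have "N ((-1) *\<^sub>R (y - x)) = \<bar>-1\<bar> * N (y - x)"
    using assms unfolding is_norm_def by blast
  then show ?thesis by simp
qed

lemma is_norm_triangle:
  assumes "is_norm N"
  shows "N (x + y) \<le> N x + N y"
  using assms unfolding is_norm_def by blast

lemma is_Lipschitz_constant_add:
  assumes "is_norm M"
    and "is_Lipschitz_constant N M Y g K" and "is_Lipschitz_constant N M Y h L"
  shows "is_Lipschitz_constant N M Y (\<lambda>y. g y + h y) (K + L)"
  unfolding is_Lipschitz_constant_def
proof (intro ballI)
  fix y y'
  assume "y \<in> Y" "y' \<in> Y"
  then have "M (g y - g y') \<le> K * N (y - y')" "M (h y - h y') \<le> L * N (y - y')"
    using assms(2,3) unfolding is_Lipschitz_constant_def by blast+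
  then show "M (g y + h y - (g y' + h y')) \<le> (K + L) * N (y - y')"
    using is_norm_triangle[OF assms(1), of "g y - g y'" "h y - h y'"]
    by (simp add: add_diff_add distrib_right)
qed

text \<open>Each inner minimum is bounded by the supremum \<open>b\<close>, and over a finite
  nonempty set it is attained, so an actual point of \<open>P\<close> realizes the bound.\<close>

lemma dispersion_obtains_near:
  assumes "finite P" "P \<noteq> {}" and "dispersion N P S = ereal b" and "s \<in> S"
  obtains d where "d \<in> P" "N (s - d) \<le> b"
proof -
  have "ereal (Min ((\<lambda>d. N (s - d)) ` P)) \<le> ereal b"
    using assms(3,4) unfolding dispersion_def by (metis SUP_upper)
  moreover have "Min ((\<lambda>d. N (s - d)) ` P) \<in> (\<lambda>d. N (s - d)) ` P"
    using assms(1,2) by (intro Min_in) auto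
  ultimately show thesis using that by auto
qed

text \<open>
  A negative \<open>L\<close> is possible only if \<open>N (y - y') = 0\<close> throughout \<open>Y\<close>; then \<open>b = 0\<close>.
\<close>

lemma Lipschitz_constant_mult_dispersion:
  assumes "is_norm N" "is_norm M" and Lip: "is_Lipschitz_constant N M Y h L"
    and P: "finite P" "P \<noteq> {}" "P \<subseteq> Y" and "S \<subseteq> Y"
    and disp: "dispersion N P S = ereal b"
    and s: "s \<in> S" and d: "d \<in> P" "N (s - d) \<le> b"
  shows "M (h s - h d) \<le> L * b"
proof -
  have le: "M (h y - h y') \<le> L * N (y - y')" if "y \<in> Y" "y' \<in> Y" for y y'
    using Lip that unfolding is_Lipschitz_constant_def by blast
  have sd: "M (h s - h d) \<le> L * N (s - d)"
    using le s d P \<open>S \<subseteq> Y\<close> by blast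
  show ?thesis
  proof (cases "0 \<le> L")
    case True
    then show ?thesis using sd mult_left_mono[OF d(2)] by fastforce
  next
    case False
    \<comment> \<open>A negative \<open>L\<close> times a positive distance would be a negative
      upper bound for a norm.\<close>
    have zero: "N (y - y') = 0" if "y \<in> Y" "y' \<in> Y" for y y'
    proof -
      have "0 \<le> L * N (y - y')"
        using le[OF that] is_norm_nonneg[OF \<open>is_norm M\<close>, of "h y - h y'"] by linarith
      with False is_norm_nonneg[OF \<open>is_norm N\<close>, of "y - y'"] show ?thesis
        by (simp add: zero_le_mult_iff)
    qed
    have "(\<lambda>d. N (t - d)) ` P = {0}" if "t \<in> S" for t
      using zero that P \<open>S \<subseteq> Y\<close> by force
    \<comment> \<open>All distances from \<open>S\<close> to \<open>P\<close> vanish, so this is the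
      supremum of a constant; the point \<open>s\<close> keeps the index set nonempty, where the
      value would otherwise be \<open>-\<infinity>\<close>.\<close>
    then have "dispersion N P S = (SUP t\<in>S. 0)"
      unfolding dispersion_def by (intro SUP_cong) (auto simp: zero_ereal_def)
    also have "\<dots> = 0"
      using s by (intro SUP_const) blast
    finally have "b = 0" using disp by simp
    with sd zero s d P \<open>S \<subseteq> Y\<close> show ?thesis by force
  qed
qed

text \<open>The value at a minimizer is a lower bound of all values, hence at most their
  infimum.\<close>

lemma max_residual_arg_min:
  assumes "is_arg_min (max_residual M \<psi> A B D) (\<lambda>_. True) c"
  shows "max_residual M \<psi> A B D c \<le> min_max_residual M \<psi> A B D"
  using assms unfolding min_max_residual_def
  by (intro cINF_greatest) (auto simp: is_arg_min_linorder)

theorem theorem4: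
  fixes N :: "(real ^ 'n) \<times> (real ^ 'm) \<Rightarrow> real"
    and M :: "real ^ 'p \<Rightarrow> real"
    and X Sx :: "(real ^ 'n) set"
    and U Su :: "(real ^ 'm) set"
    and Sxu St :: "((real ^ 'n) \<times> (real ^ 'm)) set"
    and f :: "real ^ 'n \<Rightarrow> real ^ 'm \<Rightarrow> real ^ 'n"
    and \<psi> :: "real ^ 'n \<Rightarrow> real ^ 'p"
    and D Dt :: "((real ^ 'n) \<times> (real ^ 'm) \<times> (real ^ 'n)) set"
    and A At :: "real ^ 'p ^ 'p"
    and B Bt :: "real ^ 'm ^ 'p"
    and b L_Delta L_E et \<epsilon>t :: real
    and ct :: "real ^ 'p"
  assumes "is_norm N" and "is_norm M"
    and "\<And>x u. x \<in> X \<Longrightarrow> u \<in> U \<Longrightarrow> f x u \<in> X"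
    and "Sxu = Sx \<times> Su" and "Sxu \<subseteq> X \<times> U"
    and "St \<subseteq> Sxu"
    and "is_data_set f X U D"
    and "dispersion N (state_input_pairs D) Sxu = ereal b"
    and "is_Lipschitz_constant N M (X \<times> U) (lifting_error_diff f \<psi> A B At Bt) L_Delta"
    and "is_Lipschitz_constant N M (X \<times> U) (lifting_error f \<psi> A B) L_E"
    and "Dt \<subseteq> D"
    and "state_input_pairs Dt = state_input_pairs D \<inter> (St + norm_ball N 0 b)"
    and "et = min_max_residual M \<psi> At Bt Dt"
    and "is_arg_min (max_residual M \<psi> At Bt Dt) (\<lambda>_. True) ct"
    and "\<epsilon>t = (L_Delta + L_E) * b + et"
  shows "Koopman_over_approximation f \<psi> At Bt (norm_ball M ct \<epsilon>t) St"
proof -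
  define E where "E = lifting_error f \<psi> At Bt"
  have "E = (\<lambda>xu. lifting_error_diff f \<psi> A B At Bt xu + lifting_error f \<psi> A B xu)"
    by (simp add: E_def lifting_error_diff_def)
  then have Lip: "is_Lipschitz_constant N M (X \<times> U) E (L_Delta + L_E)"
    using is_Lipschitz_constant_add[OF assms(2,9,10)] by simp
  have P: "finite (state_input_pairs D)" "state_input_pairs D \<noteq> {}" "state_input_pairs D \<subseteq> X \<times> U"
    using assms(7) unfolding is_data_set_def state_input_pairs_def by auto
  have "E s \<in> norm_ball M ct \<epsilon>t" if "s \<in> St" for s
  proof -
    have s: "s \<in> Sxu" using that assms(6) by blast
    obtain d where d: "d \<in> state_input_pairs D" "N (s - d) \<le> b"
      using dispersion_obtains_near[OF P(1,2) assms(8) s] .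
    have near: "M (E s - E d) \<le> (L_Delta + L_E) * b"
      using Lipschitz_constant_mult_dispersion[OF assms(1,2) Lip P assms(5,8) s d] .
    \<comment> \<open>Writing \<open>d = s + (d - s)\<close> with \<open>s \<in> St\<close> puts
      \<open>d\<close> into the Minkowski sum that selects \<open>Dt\<close>.\<close>
    have "d - s \<in> norm_ball N 0 b"
      using d(2) is_norm_minus_commute[OF assms(1)] by (simp add: norm_ball_def)
    then have "s + (d - s) \<in> St + norm_ball N 0 b"
      using that by (rule set_plus_intro[rotated])
    then have "d \<in> state_input_pairs Dt" using d(1) assms(12) by simp
    then obtain x u x' where xu: "d = (x, u)" "(x, u, x') \<in> Dt"
      by (auto simp: state_input_pairs_def)
    \<comment> \<open>\<open>E d\<close> is formed with \<open>f x u\<close>, the residual with the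
      recorded successor \<open>x'\<close>; once they agree, \<open>M (E d - ct)\<close> is one of
      the values under the maximum.\<close>
    moreover have "x' = f x u"
      using xu(2) assms(7,11) unfolding is_data_set_def by blast
    moreover have "finite Dt"
      using assms(7,11) unfolding is_data_set_def by (blast intro: finite_subset)
    ultimately have "M (E d - ct) \<le> max_residual M \<psi> At Bt Dt ct"
      unfolding max_residual_def E_def lifting_error_def
      by (intro Max_ge finite_imageI image_eqI[of _ _ "(x, u, x')"]) simp_all
    also have "\<dots> \<le> et"
      using max_residual_arg_min[OF assms(14)] assms(13) by simp
    \<comment> \<open>Split \<open>E s - ct\<close> at \<open>E d\<close>: the two parts contribute
      the two summands of \<open>\<epsilon>t\<close>.\<close>
    finally have "M (E s - ct) \<le> \<epsilon>t"
      using near is_norm_triangle[OF assms(2), of "E s - E d" "E d - ct"] assms(15) by simp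
    then show ?thesis by (simp add: norm_ball_def)
  qed
  then show ?thesis by (simp add: Koopman_over_approximation_def E_def)
qed

end
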